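(* Let $n\ge 2$ be an integer, let $\Omega_{(n)}\subset\mathbb{R}^n$ be an open ball $\{\underline{x}:\|\underline{x}\|<R\}$ with $0<R<\infty$ or an annulus $\{\underline{x}: R_i<\|\underline{x}\|<R_o\}$ with $0<R_i<R_o<\infty$, and let $\underline{v}:\Omega_{(n)}\to\mathbb{R}^n$ be a continuously differentiable vector field. At all points of $\Omega_{(n)}$ with $r>0$ and $\vartheta_1,\dots,\vartheta_{n-2}\in(0,\pi)$, write $\underline{v}$ in the spherical polar unit vectors as $$\underline{v}=v_r\,\underline{\mathfrak e}_r+\sum_{k=1}^{n-2}v_{\vartheta_k}\,\underline{\mathfrak e}_{\vartheta_k}+v_\varphi\,\underline{\mathfrak e}_\varphi ,$$ where $v_r,v_{\vartheta_1},\dots,v_{\vartheta_{n-2}},v_\varphi$ are regarded as functions of $(r,\vartheta_1,\dots,\vartheta_{n-2},\varphi)$. Then at every such point the divergence $\operatorname{div}\underline{v}=\sum_{j=1}^n \partial v_j/\partial x_j$ (with $v_j$ the Cartesian components of $\underline{v}$) is given as follows. For $n=2$: $$\operatorname{div}\underline{v}=\frac1r\left(\frac{\partial (r\,v_r)}{\partial r}+\frac{\partial v_\varphi}{\partial\varphi}\right).$$ For $n\ge 3$: $$\operatorname{div}\underline{v}=\frac{1}{r^{n-1}}\frac{\partial (r^{n-1}v_r)}{\partial r}+\sum_{k=1}^{n-2}\frac{1}{r\,\Big(\prod_{i=1}^{k-1}\sin\vartheta_i\Big)\,\sin^{\,n-1-k}\vartheta_k}\,\frac{\partial\big(\sin^{\,n-1-k}\vartheta_k\;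 v_{\vartheta_k}\big)}{\partial\vartheta_k}+\frac{1}{r\,\prod_{i=1}^{n-2}\sin\vartheta_i}\,\frac{\partial v_\varphi}{\partial\varphi},$$ with empty products equal to $1$.
   Context: Spherical polar coordinates $(r,\vartheta_1,\dots,\vartheta_{n-2},\varphi)$ in $\mathbb{R}^n$, $n\ge3$, with $r=\|\underline{x}\|\in[0,\infty)$, $\vartheta_1,\dots,\vartheta_{n-2}\in[0,\pi]$, $\varphi\in[0,2\pi]$, are defined by $$x_1=r\sin\vartheta_1\cdots\sin\vartheta_{n-2}\cos\varphi,\qquad x_2=r\sin\vartheta_1\cdots\sin\vartheta_{n-2}\sin\varphi,$$ $$x_j=r\,\Big(\prod_{i=1}^{n-j}\sin\vartheta_i\Big)\cos\vartheta_{n-j+1}\quad (3\le j\le n),$$ so in particular $x_3=r\sin\vartheta_1\cdots\sin\vartheta_{n-3}\cos\vartheta_{n-2}$, $x_{n-1}=r\sin\vartheta_1\cos\vartheta_2$ (for $n\geq 4$) and $x_n=r\cos\vartheta_1$. For $n=2$ there are no $\vartheta_k$, and $x_1=r\cos\varphi$, $x_2=r\sin\varphi$. Functions of $\varphi$ are understood as extended $2\pi$-periodically, so that $\partial/\partial\varphi$ makes sense at $\varphi=0,2\pi$. The unit vectors of the spherical polar system are the normalized columns of the Jacobian matrix of $\underline{x}$ with respect to $(r,\vartheta_1,\dots,\vartheta_{n-2},\varphi)$: $\underline{\mathfrak e}_q=\dfrac{\partial\underline{x}/\partial q}{\|\partial\underline{x}/\partial q\|}$ for $q\in\{r,\vartheta_1,\dots,\vartheta_{n-2},\varphi\}$.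 They are pairwise orthonormal where defined, with $\|\partial\underline{x}/\partial r\|=1$, $\|\partial\underline{x}/\partial\vartheta_k\|=r\prod_{i=1}^{k-1}\sin\vartheta_i$, $\|\partial\underline{x}/\partial\varphi\|=r\prod_{i=1}^{n-2}\sin\vartheta_i$. Here $\|\cdot\|$ is the Euclidean norm. *)

theory Defs
  imports "HOL-Analysis.Analysis"
begin

text \<open>Throughout, \<open>idx :: 'n \<Rightarrow> nat\<close> numbers the Cartesian coordinates of \<open>real ^ 'n\<close> by
  \<open>1, \<dots>, CARD('n)\<close>, and the polar angles are a function \<open>\<theta> :: nat \<Rightarrow> real\<close> of which only
  \<open>\<theta> 1, \<dots>, \<theta> (CARD('n) - 2)\<close> matter.\<close>

definition polar_coord :: "nat \<Rightarrow> real \<Rightarrow> (nat \<Rightarrow> real) \<Rightarrow> real \<Rightarrow> nat \<Rightarrow> real" where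
  "polar_coord n r \<theta> \<phi> j =
     (if j = 1 then r * (\<Prod>i=1..n-2. sin (\<theta> i)) * cos \<phi>
      else if j = 2 then r * (\<Prod>i=1..n-2. sin (\<theta> i)) * sin \<phi>
      else r * (\<Prod>i=1..n-j. sin (\<theta> i)) * cos (\<theta> (n - j + 1)))"

definition polar_point :: "('n::finite \<Rightarrow> nat) \<Rightarrow> real \<Rightarrow> (nat \<Rightarrow> real) \<Rightarrow> real \<Rightarrow> real ^ 'n" where
  "polar_point idx r \<theta> \<phi> = (\<chi> i. polar_coord CARD('n) r \<theta> \<phi> (idx i))"

definition normalized :: "'a::real_normed_vector \<Rightarrow> 'a" where
  "normalized w = (1 / norm w) *\<^sub>R w"

definition unit_r :: "('n::finite \<Rightarrow> nat) \<Rightarrow> real \<Rightarrow> (nat \<Rightarrow> real) \<Rightarrow> real \<Rightarrow> real ^ 'n" where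
  "unit_r idx r \<theta> \<phi> =
     normalized (vector_derivative (\<lambda>s. polar_point idx s \<theta> \<phi>) (at r))"

definition unit_theta ::
    "('n::finite \<Rightarrow> nat) \<Rightarrow> nat \<Rightarrow> real \<Rightarrow> (nat \<Rightarrow> real) \<Rightarrow> real \<Rightarrow> real ^ 'n" where
  "unit_theta idx k r \<theta> \<phi> =
     normalized (vector_derivative (\<lambda>t. polar_point idx r (\<theta>(k := t)) \<phi>) (at (\<theta> k)))"

definition unit_phi :: "('n::finite \<Rightarrow> nat) \<Rightarrow> real \<Rightarrow> (nat \<Rightarrow> real) \<Rightarrow> real \<Rightarrow> real ^ 'n" where
  "unit_phi idx r \<theta> \<phi> =
     normalized (vector_derivative (\<lambda>\<psi>. polar_point idx r \<theta> \<psi>) (at \<phi>))"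

definition regular_polar :: "nat \<Rightarrow> real \<Rightarrow> (nat \<Rightarrow> real) \<Rightarrow> bool" where
  "regular_polar n r \<theta> \<longleftrightarrow> r > 0 \<and> (\<forall>k\<in>{1..n-2}. 0 < \<theta> k \<and> \<theta> k < pi)"

text \<open>The expansion is required for every real \<open>\<phi>\<close>, not only for \<open>\<phi> \<in> [0, 2\<pi>]\<close>: since
  the polar parametrization and its unit vectors are \<open>2\<pi>\<close>-periodic in \<open>\<phi>\<close>, this says exactly
  that the components are extended \<open>2\<pi>\<close>-periodically.\<close>

definition polar_components ::
    "('n::finite \<Rightarrow> nat) \<Rightarrow> (real ^ 'n) set \<Rightarrow> (real ^ 'n \<Rightarrow> real ^ 'n)
     \<Rightarrow> (real \<Rightarrow> (nat \<Rightarrow> real) \<Rightarrow> real \<Rightarrow> real)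
     \<Rightarrow> (nat \<Rightarrow> real \<Rightarrow> (nat \<Rightarrow> real) \<Rightarrow> real \<Rightarrow> real)
     \<Rightarrow> (real \<Rightarrow> (nat \<Rightarrow> real) \<Rightarrow> real \<Rightarrow> real) \<Rightarrow> bool" where
  "polar_components idx \<Omega> v v\<^sub>r v\<^sub>\<theta> v\<^sub>\<phi> \<longleftrightarrow>
     (\<forall>r \<theta> \<phi>. regular_polar CARD('n) r \<theta> \<longrightarrow> polar_point idx r \<theta> \<phi> \<in> \<Omega> \<longrightarrow>
        v (polar_point idx r \<theta> \<phi>) =
          v\<^sub>r r \<theta> \<phi> *\<^sub>R unit_r idx r \<theta> \<phi>
          + (\<Sum>k=1..CARD('n)-2. v\<^sub>\<theta> k r \<theta> \<phi> *\<^sub>R unit_theta idx k r \<theta> \<phi>)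
          + v\<^sub>\<phi> r \<theta> \<phi> *\<^sub>R unit_phi idx r \<theta> \<phi>)"

definition continuously_differentiable_on ::
    "('a::real_normed_vector \<Rightarrow> 'b::real_normed_vector) \<Rightarrow> 'a set \<Rightarrow> bool" where
  "continuously_differentiable_on f S \<longleftrightarrow>
     (\<exists>f' :: 'a \<Rightarrow> 'a \<Rightarrow>\<^sub>L 'b.
        (\<forall>x\<in>S. (f has_derivative blinfun_apply (f' x)) (at x)) \<and> continuous_on S f')"

definition divergence :: "(real ^ 'n \<Rightarrow> real ^ 'n) \<Rightarrow> real ^ 'n::finite \<Rightarrow> real" where
  "divergence v x = (\<Sum>j\<in>UNIV. deriv (\<lambda>t. v (x + t *\<^sub>R axis j 1) $ j) 0)"

end

theory Submission
  imports Defs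
begin

text \<open>The divergence is the trace of the derivative \<open>D\<close>, hence the sum of \<open>D e \<bullet> e\<close> over the polar unit
  vectors \<open>e\<close>. The product rule turns each summand into a derivative of the component \<open>v \<bullet> e\<close> along
  the coordinate line of \<open>e\<close>, minus \<open>v\<close> paired with the derivative of \<open>e\<close> along that line.

  With the azimuth as last angle \<open>\<alpha> (n-1)\<close> and the Cartesian axes suitably ordered, the direction of
  the point is \<open>W 1\<close>, where \<open>W = tail \<alpha>\<close>, \<open>W k = cos (\<alpha> k) b k + sin (\<alpha> k) W (k+1)\<close>, \<open>W n = b n\<close>, and the
  \<open>k\<close>-th angular unit vector, \<open>E = frame \<alpha>\<close>, is \<open>E k = - sin (\<alpha> k) b k + cos (\<alpha> k) W (k+1)\<close>. Its derivative in \<open>\<alpha> k\<close> is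
  \<open>- W k\<close>, and expanding \<open>W k\<close> in \<open>W 1, E 1, \<dots>, E (k-1)\<close> produces exactly the terms that the
  weights \<open>r^(n-1)\<close> and \<open>sin^(n-1-k)\<close> contribute inside the derivatives.\<close>

section \<open>The nested rotation frame of an orthonormal family\<close>

locale orthonormal_family =
  fixes b :: "nat \<Rightarrow> 'a::real_inner" and n :: nat
  assumes n_pos: "1 \<le> n"
    and inner_b: "\<lbrakk>p \<in> {1..n}; q \<in> {1..n}\<rbrakk> \<Longrightarrow> b p \<bullet> b q = (if p = q then 1 else 0)"
begin

text \<open>For \<open>k\<close> in \<open>1..n\<close> this is the recursion for \<open>W\<close>
  solved in closed form: the unit vector in the span of \<open>b k\<close>, ..., \<open>b n\<close>
  with polar angles \<open>\<alpha> k\<close>, ..., \<open>\<alpha> (n-1)\<close>.\<close>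

definition tail :: "(nat \<Rightarrow> real) \<Rightarrow> nat \<Rightarrow> 'a" where
  "tail \<alpha> k = (\<Sum>p=k..<n. ((\<Prod>l=k..<p. sin (\<alpha> l)) * cos (\<alpha> p)) *\<^sub>R b p)
     + (\<Prod>l=k..<n. sin (\<alpha> l)) *\<^sub>R b n"

definition frame :: "(nat \<Rightarrow> real) \<Rightarrow> nat \<Rightarrow> 'a" where
  "frame \<alpha> k = - sin (\<alpha> k) *\<^sub>R b k + cos (\<alpha> k) *\<^sub>R tail \<alpha> (Suc k)"

lemma tail_last: "tail \<alpha> n = b n"
  by (simp add: tail_def)

lemma tail_rec:
  assumes "k < n"
  shows "tail \<alpha> k = cos (\<alpha> k) *\<^sub>R b k + sin (\<alpha> k) *\<^sub>R tail \<alpha> (Suc k)"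
proof -
  have "(\<Sum>p=Suc k..<n. ((\<Prod>l=k..<p. sin (\<alpha> l)) * cos (\<alpha> p)) *\<^sub>R b p)
      = sin (\<alpha> k) *\<^sub>R (\<Sum>p=Suc k..<n. ((\<Prod>l=Suc k..<p. sin (\<alpha> l)) * cos (\<alpha> p)) *\<^sub>R b p)"
    unfolding scaleR_sum_right
    by (intro sum.cong refl) (simp add: prod.atLeast_Suc_lessThan mult.assoc)
  then show ?thesis
    using assms
    by (simp add: tail_def sum.atLeast_Suc_lessThan prod.atLeast_Suc_lessThan[of k n] algebra_simps)
qed

text \<open>Earlier angles do not enter, so varying \<open>\<alpha> k\<close> leaves the tail at
  \<open>Suc k\<close> fixed. The derivatives in a single angle rest on this.\<close>

lemma tail_cong:
  assumes "\<And>l. k \<le> l \<Longrightarrow> \<alpha> l = \<beta> l"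
  shows "tail \<alpha> k = tail \<beta> k"
  using assms by (simp add: tail_def)

lemma tail_Suc_upd [simp]: "tail (\<alpha>(k := t)) (Suc k) = tail \<alpha> (Suc k)"
  by (rule tail_cong) auto

lemma inner_b_tail:
  assumes "1 \<le> p" "p < k" "k \<le> n"
  shows "b p \<bullet> tail \<alpha> k = 0"
  using assms(3,1,2)
proof (induction k rule: inc_induct)
  case base
  then show ?case by (simp add: tail_last inner_b)
next
  case (step k)
  then show ?case by (simp add: tail_rec inner_b inner_add_right)
qed

lemma inner_tail_tail:
  assumes "1 \<le> k" "k \<le> n"
  shows "tail \<alpha> k \<bullet> tail \<alpha> k = 1"
  using assms(2,1)
proof (induction k rule: inc_induct)
  case base
  then show ?case by (simp add: tail_last inner_b)
next
  case (step k)
  then have "tail \<alpha> (Suc k) \<bullet> tail \<alpha> (Suc k) = 1" "b k \<bullet> tail \<alpha> (Suc k) = 0"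
    "tail \<alpha> (Suc k) \<bullet> b k = 0" "b k \<bullet> b k = 1"
    by (auto simp: inner_b_tail inner_b inner_commute[of "tail \<alpha> (Suc k)" "b k"])
  with step show ?case
    by (simp add: tail_rec inner_add_left inner_add_right)
qed

context
  fixes k and \<alpha> :: "nat \<Rightarrow> real"
  assumes k: "1 \<le> k" "k < n"
begin

private lemma step_inner:
  "tail \<alpha> (Suc k) \<bullet> tail \<alpha> (Suc k) = 1" "b k \<bullet> tail \<alpha> (Suc k) = 0"
  "tail \<alpha> (Suc k) \<bullet> b k = 0" "b k \<bullet> b k = 1"
  using k by (auto simp: inner_tail_tail inner_b_tail inner_b inner_commute[of "tail \<alpha> (Suc k)" "b k"])

lemma inner_frame_frame: "frame \<alpha> k \<bullet> frame \<alpha> k = 1"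
  using step_inner
  by (simp add: frame_def inner_add_left inner_add_right inner_diff_left inner_diff_right)

lemma inner_b_frame:
  assumes "1 \<le> p" "p < k"
  shows "b p \<bullet> frame \<alpha> k = 0"
  using assms k by (simp add: frame_def inner_b inner_b_tail inner_add_right inner_diff_right)

text \<open>At \<open>j = k\<close> the two products of sine and cosine cancel; for smaller
  \<open>j\<close>, both \<open>b j\<close> and the next tail are orthogonal to
  \<open>frame \<alpha> k\<close>.\<close>

lemma inner_tail_frame:
  assumes "1 \<le> j" "j \<le> k"
  shows "tail \<alpha> j \<bullet> frame \<alpha> k = 0"
  using assms(2,1)
proof (induction j rule: inc_induct)
  case base
  then show ?case
    using k step_inner
    by (simp add: frame_def tail_rec inner_add_left inner_add_right inner_diff_right)
next
  case (step j)
  then show ?case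
    using k by (simp add: tail_rec[of j] inner_b_frame inner_add_left)
qed

lemma inner_frame_frame_less:
  assumes "1 \<le> j" "j < k"
  shows "frame \<alpha> j \<bullet> frame \<alpha> k = 0"
  using assms
  by (simp add: frame_def[of \<alpha> j] inner_b_frame inner_tail_frame inner_add_left inner_diff_left)

lemma norm_frame: "norm (frame \<alpha> k) = 1"
  by (simp add: norm_eq_sqrt_inner inner_frame_frame)

text \<open>This inverts the plane rotation taking \<open>b k\<close> and the tail at
  \<open>Suc k\<close> to the tail and the frame vector at \<open>k\<close>.\<close>

lemma tail_Suc_eq: "tail \<alpha> (Suc k) = sin (\<alpha> k) *\<^sub>R tail \<alpha> k + cos (\<alpha> k) *\<^sub>R frame \<alpha> k"
proof -
  have "sin (\<alpha> k) *\<^sub>R tail \<alpha> k + cos (\<alpha> k) *\<^sub>R frame \<alpha> k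
      = (cos (\<alpha> k) * cos (\<alpha> k) + sin (\<alpha> k) * sin (\<alpha> k)) *\<^sub>R tail \<alpha> (Suc k)"
    using k by (simp add: tail_rec frame_def algebra_simps del: sin_cos_squared_add3)
  then show ?thesis
    by simp
qed

text \<open>Each level of the recursion from \<open>j\<close> to \<open>k - 1\<close> multiplies the
  moving part by one sine; so the scale factor of the angle arises.\<close>

lemma tail_has_vector_derivative:
  assumes "1 \<le> j" "j \<le> k"
  shows "((\<lambda>t. tail (\<alpha>(k := t)) j) has_vector_derivative
           (\<Prod>i=j..<k. sin (\<alpha> i)) *\<^sub>R frame \<alpha> k) (at (\<alpha> k))"
  using assms(2,1)
proof (induction j rule: inc_induct)
  case base
  have eq: "(\<lambda>t. tail (\<alpha>(k := t)) k) = (\<lambda>t. cos t *\<^sub>R b k + sin t *\<^sub>R tail \<alpha> (Suc k))"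
    using k by (simp add: tail_rec fun_eq_iff)
  show ?case
    unfolding eq by (auto simp: frame_def intro!: derivative_eq_intros)
next
  case (step j)
  have eq: "(\<lambda>t. tail (\<alpha>(k := t)) j)
      = (\<lambda>t. cos (\<alpha> j) *\<^sub>R b j + sin (\<alpha> j) *\<^sub>R tail (\<alpha>(k := t)) (Suc j))"
    using step k by (simp add: tail_rec[of j] fun_eq_iff)
  have IH: "((\<lambda>t. tail (\<alpha>(k := t)) (Suc j)) has_vector_derivative
           (\<Prod>i=Suc j..<k. sin (\<alpha> i)) *\<^sub>R frame \<alpha> k) (at (\<alpha> k))"
    by (rule step.IH) simp
  have "((\<lambda>t. cos (\<alpha> j) *\<^sub>R b j + sin (\<alpha> j) *\<^sub>R tail (\<alpha>(k := t)) (Suc j)) has_vector_derivative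
      0 + sin (\<alpha> j) *\<^sub>R (\<Prod>i=Suc j..<k. sin (\<alpha> i)) *\<^sub>R frame \<alpha> k) (at (\<alpha> k))"
    by (intro has_vector_derivative_add has_vector_derivative_const
        bounded_linear.has_vector_derivative[OF bounded_linear_scaleR_right IH])
  then show ?case
    unfolding eq using step(2) by (simp add: prod.atLeast_Suc_lessThan)
qed

text \<open>The plane of \<open>b k\<close> and the tail at \<open>Suc k\<close> stays fixed as
  \<open>\<alpha> k\<close> varies. In it the frame vector is the tail turned by a right angle, and
  differentiating turns it once more.\<close>

lemma frame_has_vector_derivative:
  "((\<lambda>t. frame (\<alpha>(k := t)) k) has_vector_derivative - tail \<alpha> k) (at (\<alpha> k))"
  unfolding frame_def using k
  by (auto simp: tail_rec[of k] intro!: derivative_eq_intros)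

end

section \<open>Expansions and traces in the rotated orthonormal frame\<close>

lemma inner_frame:
  assumes "j \<in> {1..<n}" "k \<in> {1..<n}"
  shows "frame \<alpha> j \<bullet> frame \<alpha> k = (if j = k then 1 else 0)"
  using assms inner_frame_frame[of k \<alpha>] inner_frame_frame_less[of k j \<alpha>] inner_frame_frame_less[of j k \<alpha>]
  by (cases j k rule: linorder_cases) (auto simp: inner_commute)

text \<open>By orthonormality the coefficients are inner products. Components known only through an
  expansion thus become accessible to the product rule.\<close>

lemma frame_expansion:
  assumes y: "y = c *\<^sub>R tail \<alpha> 1 + (\<Sum>k=1..<n. d k *\<^sub>R frame \<alpha> k)"
  shows "y \<bullet> tail \<alpha> 1 = c"
    and "k \<in> {1..<n} \<Longrightarrow> y \<bullet> frame \<alpha> k = d k"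
proof -
  have "(\<Sum>k=1..<n. d k * (frame \<alpha> k \<bullet> tail \<alpha> 1)) = 0"
    by (intro sum.neutral ballI) (metis atLeastLessThan_iff inner_commute inner_tail_frame le_refl mult_zero_right)
  then show "y \<bullet> tail \<alpha> 1 = c"
    using n_pos by (simp add: y inner_add_left inner_sum_left inner_tail_tail)
  assume k: "k \<in> {1..<n}"
  have "(\<Sum>j=1..<n. d j * (frame \<alpha> j \<bullet> frame \<alpha> k)) = (\<Sum>j=1..<n. if j = k then d j else 0)"
    using k by (intro sum.cong refl) (simp add: inner_frame)
  then show "y \<bullet> frame \<alpha> k = d k"
    using k by (simp add: y inner_add_left inner_sum_left inner_tail_frame)
qed

text \<open>These coordinates will be matched with \<open>polar_coord\<close>; the last one carries
  no cosine because no angle is left.\<close>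

lemma inner_tail_b:
  assumes "p \<in> {1..n}"
  shows "tail \<alpha> 1 \<bullet> b p = (\<Prod>l=1..<p. sin (\<alpha> l)) * (if p < n then cos (\<alpha> p) else 1)"
proof -
  have "(\<Sum>q=1..<n. (\<Prod>l=1..<q. sin (\<alpha> l)) * cos (\<alpha> q) * (b q \<bullet> b p))
      = (\<Sum>q=1..<n. if q = p then (\<Prod>l=1..<q. sin (\<alpha> l)) * cos (\<alpha> q) else 0)"
    using assms by (intro sum.cong refl) (simp add: inner_b)
  then show ?thesis
    using assms n_pos by (auto simp: tail_def inner_add_left inner_sum_left inner_b)
qed

text \<open>Each step from \<open>(b k, tail \<alpha> (Suc k))\<close> to \<open>(tail \<alpha> k, frame \<alpha> k)\<close> is a plane rotation, which
  preserves the partial trace.\<close>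

lemma trace_frame:
  assumes "bounded_linear D"
  shows "(\<Sum>p=1..n. D (b p) \<bullet> b p) = D (tail \<alpha> 1) \<bullet> tail \<alpha> 1 + (\<Sum>k=1..<n. D (frame \<alpha> k) \<bullet> frame \<alpha> k)"
proof -
  interpret D: bounded_linear D by fact
  have "(\<Sum>p=j..n. D (b p) \<bullet> b p)
      = D (tail \<alpha> j) \<bullet> tail \<alpha> j + (\<Sum>k=j..<n. D (frame \<alpha> k) \<bullet> frame \<alpha> k)" if "1 \<le> j" "j \<le> n" for j
    using that(2,1)
  proof (induction j rule: inc_induct)
    case base
    then show ?case by (simp add: tail_last)
  next
    case (step j)
    let ?s = "sin (\<alpha> j)" and ?c = "cos (\<alpha> j)" and ?w = "tail \<alpha> (Suc j)"
    \<comment> \<open>The mixed terms pairing \<open>b j\<close> with \<open>?w\<close> cancel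
      between the two summands.\<close>
    have "D (tail \<alpha> j) \<bullet> tail \<alpha> j + D (frame \<alpha> j) \<bullet> frame \<alpha> j
        = (?c * ?c + ?s * ?s) * (D (b j) \<bullet> b j + D ?w \<bullet> ?w)"
      using step(2)
      by (simp add: tail_rec[of j] frame_def D.add D.diff D.neg D.scaleR
          algebra_simps del: sin_cos_squared_add3)
    then have "D (tail \<alpha> j) \<bullet> tail \<alpha> j + D (frame \<alpha> j) \<bullet> frame \<alpha> j = D (b j) \<bullet> b j + D ?w \<bullet> ?w"
      by simp
    with step show ?case
      by (simp add: sum.atLeast_Suc_atMost[of j] sum.atLeast_Suc_lessThan[of j])
  qed
  then show ?thesis
    using n_pos by simp
qed

text \<open>Divided by the product of sines up to \<open>k\<close>, \<open>tail_Suc_eq\<close>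
  becomes a recursion in which every step adds one term. As \<open>k < n\<close>, only sines below
  index \<open>n - 1\<close> are divided by.\<close>

lemma inner_tail_expansion:
  assumes "1 \<le> k" "k < n" "\<And>i. i \<in> {1..<n-1} \<Longrightarrow> sin (\<alpha> i) \<noteq> 0"
  shows "y \<bullet> tail \<alpha> k / (\<Prod>i=1..<k. sin (\<alpha> i))
    = y \<bullet> tail \<alpha> 1 + (\<Sum>i=1..<k. cos (\<alpha> i) * (y \<bullet> frame \<alpha> i) / (\<Prod>l=1..<Suc i. sin (\<alpha> l)))"
  using assms(1,2)
proof (induction k rule: dec_induct)
  case base
  then show ?case by simp
next
  case (step k)
  have nz: "sin (\<alpha> k) \<noteq> 0" "(\<Prod>i=1..<k. sin (\<alpha> i)) \<noteq> 0"
    using step assms(3) by auto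
  have "y \<bullet> tail \<alpha> (Suc k) / (\<Prod>i=1..<Suc k. sin (\<alpha> i))
      = y \<bullet> tail \<alpha> k / (\<Prod>i=1..<k. sin (\<alpha> i))
        + cos (\<alpha> k) * (y \<bullet> frame \<alpha> k) / (\<Prod>i=1..<Suc k. sin (\<alpha> i))"
    using step nz by (simp add: tail_Suc_eq inner_add_right field_simps)
  with step show ?case
    by simp
qed

text \<open>Summing over \<open>k\<close> counts the \<open>i\<close>-th term once for each
  \<open>k\<close> with \<open>i < k < n\<close>. The multiplicities \<open>n-1\<close> and
  \<open>n-1-i\<close> are the exponents of the weights in the divergence formula.\<close>

lemma sum_inner_tail:
  assumes "\<And>i. i \<in> {1..<n-1} \<Longrightarrow> sin (\<alpha> i) \<noteq> 0"
  shows "(\<Sum>k=1..<n. y \<bullet> tail \<alpha> k / (\<Prod>i=1..<k. sin (\<alpha> i)))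
    = real (n-1) * (y \<bullet> tail \<alpha> 1)
      + (\<Sum>i=1..<n. real (n-1-i) * (cos (\<alpha> i) * (y \<bullet> frame \<alpha> i) / (\<Prod>l=1..<Suc i. sin (\<alpha> l))))"
proof -
  let ?g = "\<lambda>i. cos (\<alpha> i) * (y \<bullet> frame \<alpha> i) / (\<Prod>l=1..<Suc i. sin (\<alpha> l))"
  \<comment> \<open>A general \<open>m\<close> allows induction: passing to \<open>Suc m\<close>
    adds each \<open>g i\<close> with \<open>i < m\<close> once more, and the new index
    \<open>m\<close> gets coefficient 0.\<close>
  have swap: "(\<Sum>k=1..<m. \<Sum>i=1..<k. g i) = (\<Sum>i=1..<m. real (m-1-i) * g i)" for m and g :: "nat \<Rightarrow> real"
  proof (induction m)
    case (Suc m)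
    have "(\<Sum>i=1..<m. real (m-i) * g i) = (\<Sum>i=1..<m. real (m-1-i) * g i + g i)"
      by (intro sum.cong refl) (auto simp: algebra_simps)
    then show ?case
      using Suc by (cases "m = 0") (simp_all add: sum.distrib)
  qed simp
  have "(\<Sum>k=1..<n. y \<bullet> tail \<alpha> k / (\<Prod>i=1..<k. sin (\<alpha> i)))
      = (\<Sum>k=1..<n. y \<bullet> tail \<alpha> 1 + (\<Sum>i=1..<k. ?g i))"
    using assms by (intro sum.cong refl inner_tail_expansion) auto
  also have "\<dots> = real (n-1) * (y \<bullet> tail \<alpha> 1) + (\<Sum>k=1..<n. \<Sum>i=1..<k. ?g i)"
    by (simp add: sum.distrib)
  finally show ?thesis
    by (simp only: swap)
qed

section \<open>Derivatives of the components along the coordinate lines\<close>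

context
  fixes v :: "'a \<Rightarrow> 'a" and D :: "'a \<Rightarrow> 'a" and r :: real and \<alpha> :: "nat \<Rightarrow> real"
  assumes D: "(v has_derivative D) (at (r *\<^sub>R tail \<alpha> 1))"
begin

text \<open>The direction is constant along a ray, so there is no correction term, unlike for the
  angles.\<close>

lemma radial_derivative:
  "((\<lambda>s. v (s *\<^sub>R tail \<alpha> 1) \<bullet> tail \<alpha> 1) has_real_derivative D (tail \<alpha> 1) \<bullet> tail \<alpha> 1) (at r)"
proof -
  have "((\<lambda>s. s *\<^sub>R tail \<alpha> 1) has_vector_derivative tail \<alpha> 1) (at r)"
    by (auto intro!: derivative_eq_intros)
  then have "((v \<circ> (\<lambda>s. s *\<^sub>R tail \<alpha> 1)) has_vector_derivative D (tail \<alpha> 1)) (at r)"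
    using D by (intro vector_derivative_diff_chain_within) (auto intro: has_derivative_at_withinI)
  then show ?thesis
    unfolding has_real_derivative_iff_has_vector_derivative comp_def
    by (rule bounded_linear.has_vector_derivative[OF bounded_linear_inner_left])
qed

lemma angular_derivative:
  assumes k: "k \<in> {1..<n}"
  shows "((\<lambda>t. v (r *\<^sub>R tail (\<alpha>(k := t)) 1) \<bullet> frame (\<alpha>(k := t)) k) has_real_derivative
     r * (\<Prod>i=1..<k. sin (\<alpha> i)) * (D (frame \<alpha> k) \<bullet> frame \<alpha> k) - v (r *\<^sub>R tail \<alpha> 1) \<bullet> tail \<alpha> k) (at (\<alpha> k))"
proof -
  interpret D: bounded_linear D using D by (rule has_derivative_bounded_linear)
  have "((\<lambda>t. r *\<^sub>R tail (\<alpha>(k := t)) 1) has_vector_derivative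
      r *\<^sub>R (\<Prod>i=1..<k. sin (\<alpha> i)) *\<^sub>R frame \<alpha> k) (at (\<alpha> k))"
    using k by (intro bounded_linear.has_vector_derivative[OF bounded_linear_scaleR_right]
        tail_has_vector_derivative) auto
  then have "((v \<circ> (\<lambda>t. r *\<^sub>R tail (\<alpha>(k := t)) 1)) has_vector_derivative
      D (r *\<^sub>R (\<Prod>i=1..<k. sin (\<alpha> i)) *\<^sub>R frame \<alpha> k)) (at (\<alpha> k))"
    by (rule vector_derivative_diff_chain_within) (use has_derivative_at_withinI[OF D] in simp)
  then have "((\<lambda>t. v (r *\<^sub>R tail (\<alpha>(k := t)) 1)) has_vector_derivative
      (r * (\<Prod>i=1..<k. sin (\<alpha> i))) *\<^sub>R D (frame \<alpha> k)) (at (\<alpha> k))"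
    by (simp add: comp_def D.scaleR)
  from bounded_bilinear.has_vector_derivative[OF bounded_bilinear_inner this
      frame_has_vector_derivative[of k \<alpha>]]
  show ?thesis
    using k by (simp add: has_real_derivative_iff_has_vector_derivative algebra_simps)
qed

text \<open>The components are compared with inner products only near the point, since the expansion
  will be known only inside the domain. The filter \<open>nhds\<close> includes the point itself, so
  values agree there as well as derivatives.\<close>

lemma trace_in_polar_coordinates:
  assumes r: "r > 0" and nz: "\<And>i. i \<in> {1..<n-1} \<Longrightarrow> sin (\<alpha> i) \<noteq> 0"
    and radial: "eventually (\<lambda>s. v (s *\<^sub>R tail \<alpha> 1) \<bullet> tail \<alpha> 1 = f s) (nhds r)"
    and angular: "\<And>k. k \<in> {1..<n} \<Longrightarrow> eventually (\<lambda>t. v (r *\<^sub>R tail (\<alpha>(k := t)) 1) \<bullet> frame (\<alpha>(k := t)) k = g k t) (nhds (\<alpha> k))"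
  shows "(\<lambda>s. s ^ (n-1) * f s) differentiable (at r)" (is ?df)
    and "k \<in> {1..<n} \<Longrightarrow> (\<lambda>t. sin t ^ (n-1-k) * g k t) differentiable (at (\<alpha> k))" (is "_ \<Longrightarrow> ?dg")
    and "(\<Sum>p=1..n. D (b p) \<bullet> b p)
      = 1 / r ^ (n-1) * deriv (\<lambda>s. s ^ (n-1) * f s) r
        + (\<Sum>k=1..<n. 1 / (r * (\<Prod>i=1..<k. sin (\<alpha> i)) * sin (\<alpha> k) ^ (n-1-k))
            * deriv (\<lambda>t. sin t ^ (n-1-k) * g k t) (\<alpha> k))" (is ?tr)
proof -
  let ?y = "v (r *\<^sub>R tail \<alpha> 1)"
  let ?S = "\<lambda>k. \<Prod>i=1..<k. sin (\<alpha> i)"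
  let ?f' = "real (n-1) * r ^ (n-1-1) * (?y \<bullet> tail \<alpha> 1) + r ^ (n-1) * (D (tail \<alpha> 1) \<bullet> tail \<alpha> 1)"
  have f_r: "f r = ?y \<bullet> tail \<alpha> 1"
    using eventually_nhds_x_imp_x[OF radial] by simp
  have "(f has_real_derivative D (tail \<alpha> 1) \<bullet> tail \<alpha> 1) (at r)"
    using radial_derivative DERIV_cong_ev[OF refl radial refl] by blast
  then have f: "((\<lambda>s. s ^ (n-1) * f s) has_real_derivative ?f') (at r)"
    by (auto intro!: derivative_eq_intros simp: f_r)
  then show ?df
    by (auto intro: differentiableI simp: has_field_derivative_def)
  let ?g' = "\<lambda>k. real (n-1-k) * sin (\<alpha> k) ^ (n-1-k-1) * cos (\<alpha> k) * (?y \<bullet> frame \<alpha> k)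
      + sin (\<alpha> k) ^ (n-1-k) * (r * ?S k * (D (frame \<alpha> k) \<bullet> frame \<alpha> k) - ?y \<bullet> tail \<alpha> k)"
  have g: "((\<lambda>t. sin t ^ (n-1-k) * g k t) has_real_derivative ?g' k) (at (\<alpha> k))" if k: "k \<in> {1..<n}" for k
  proof -
    have g_k: "g k (\<alpha> k) = ?y \<bullet> frame \<alpha> k"
      using eventually_nhds_x_imp_x[OF angular[OF k]] by simp
    have "(g k has_real_derivative r * ?S k * (D (frame \<alpha> k) \<bullet> frame \<alpha> k) - ?y \<bullet> tail \<alpha> k) (at (\<alpha> k))"
      using angular_derivative[OF k] DERIV_cong_ev[OF refl angular[OF k] refl] by blast
    then show ?thesis
      by (auto intro!: derivative_eq_intros simp: g_k)
  qed
  then show ?dg if "k \<in> {1..<n}"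
    using that by (meson differentiableI has_field_derivative_def)
  \<comment> \<open>For \<open>n = 1\<close> the truncated exponent \<open>n-1-1\<close> is harmless
    because its coefficient is zero.\<close>
  have rad: "1 / r ^ (n-1) * ?f' = real (n-1) / r * (?y \<bullet> tail \<alpha> 1) + D (tail \<alpha> 1) \<bullet> tail \<alpha> 1"
    using r by (cases "n - 1") (auto simp: field_simps)
  have ang: "1 / (r * ?S k * sin (\<alpha> k) ^ (n-1-k)) * ?g' k
      = real (n-1-k) * (cos (\<alpha> k) * (?y \<bullet> frame \<alpha> k) / ?S (Suc k)) / r
        + D (frame \<alpha> k) \<bullet> frame \<alpha> k - ?y \<bullet> tail \<alpha> k / ?S k / r" if k: "k \<in> {1..<n}" for k
  proof -
    have S: "?S k \<noteq> 0"
      using nz k by auto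
    show ?thesis
    \<comment> \<open>For \<open>k = n - 1\<close> the exponent is zero and
      \<open>sin (\<alpha> k)\<close> may vanish; otherwise \<open>k < n - 1\<close> and
      \<open>nz\<close> applies.\<close>
    proof (cases "n - 1 - k")
      case 0
      with S r show ?thesis by (simp add: field_simps)
    next
      case (Suc m)
      then have "sin (\<alpha> k) \<noteq> 0"
        using nz k by auto
      with S r k Suc show ?thesis by (simp add: field_simps)
    qed
  qed
  have "1 / r ^ (n-1) * deriv (\<lambda>s. s ^ (n-1) * f s) r
        + (\<Sum>k=1..<n. 1 / (r * ?S k * sin (\<alpha> k) ^ (n-1-k))
            * deriv (\<lambda>t. sin t ^ (n-1-k) * g k t) (\<alpha> k))
      = 1 / r ^ (n-1) * ?f' + (\<Sum>k=1..<n. 1 / (r * ?S k * sin (\<alpha> k) ^ (n-1-k)) * ?g' k)"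
    using DERIV_imp_deriv[OF f] DERIV_imp_deriv[OF g] by simp
  \<comment> \<open>The parenthesized remainder is what the weights contribute minus what the moving
    frame takes away; \<open>sum_inner_tail\<close> makes it zero.\<close>
  also have "\<dots> = D (tail \<alpha> 1) \<bullet> tail \<alpha> 1 + (\<Sum>k=1..<n. D (frame \<alpha> k) \<bullet> frame \<alpha> k)
      + (real (n-1) * (?y \<bullet> tail \<alpha> 1)
        + (\<Sum>k=1..<n. real (n-1-k) * (cos (\<alpha> k) * (?y \<bullet> frame \<alpha> k) / ?S (Suc k)))
        - (\<Sum>k=1..<n. ?y \<bullet> tail \<alpha> k / ?S k)) / r"
    unfolding rad
    by (simp only: sum.cong[OF refl ang] sum.distrib sum_subtractf sum_divide_distrib[symmetric])
       (simp add: add_divide_distrib diff_divide_distrib)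
  also have "\<dots> = (\<Sum>p=1..n. D (b p) \<bullet> b p)"
    using trace_frame[OF has_derivative_bounded_linear[OF D], of \<alpha>] sum_inner_tail[of \<alpha> ?y, OF nz]
    by simp
  finally show ?tr ..
qed

end

end

section \<open>Auxiliary facts on sums, normalization and curves\<close>

lemma sum_split_last:
  fixes f :: "nat \<Rightarrow> 'b::comm_monoid_add"
  assumes "2 \<le> n"
  shows "(\<Sum>k=1..<n. f k) = (\<Sum>k=1..n-2. f k) + f (n - 1)"
proof -
  obtain m where "n = Suc (Suc m)"
    using assms by (metis Suc_le_D numeral_2_eq_2 Suc_le_mono)
  then show ?thesis
    by (simp add: atLeastLessThanSuc_atLeastAtMost)
qed

lemma normalized_vector_derivative:
  assumes "(f has_vector_derivative c *\<^sub>R e) (at t)" "0 < c" "norm e = 1"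
  shows "normalized (vector_derivative f (at t)) = e"
  using assms by (simp add: normalized_def vector_derivative_at)

lemma eventually_nhds_curve_in_open:
  assumes "(c has_vector_derivative c') (at t)" "open \<Omega>" "c t \<in> \<Omega>"
  shows "eventually (\<lambda>s. c s \<in> \<Omega>) (nhds t)"
proof -
  have "(c \<longlongrightarrow> c t) (nhds t)"
    using has_vector_derivative_continuous[OF assms(1)]
    by (simp add: continuous_at tendsto_at_iff_tendsto_nhds)
  then show ?thesis
    using assms(2,3) by (rule topological_tendstoD)
qed

text \<open>The basis vectors are ordered so that the azimuth \<open>\<phi>\<close> becomes the angle number
  \<open>n - 1\<close> and obeys the same formulas as the \<open>\<theta> k\<close>: \<open>x\<^sub>n, \<dots>, x\<^sub>3, x\<^sub>1, x\<^sub>2\<close>.\<close>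

definition polar_order :: "nat \<Rightarrow> nat \<Rightarrow> nat" where
  "polar_order n p = (if p = n then 2 else if p = n - 1 then 1 else n + 1 - p)"

lemma bij_betw_polar_order:
  assumes "2 \<le> n"
  shows "bij_betw (polar_order n) {1..n} {1..n}"
  by (rule bij_betw_byWitness[where f' = "\<lambda>j. if j = 1 then n - 1 else if j = 2 then n else n + 1 - j"])
     (use assms in \<open>auto simp: polar_order_def\<close>)

section \<open>Spherical polar coordinates as an instance of the rotated frame\<close>

locale polar_coordinates =
  fixes idx :: "'n::finite \<Rightarrow> nat" and n :: nat
  assumes bij_idx: "bij_betw idx UNIV {1..n}"
    and card_ge_2: "2 \<le> n"
    and card_eq: "CARD('n) = n"
begin

definition coord :: "nat \<Rightarrow> 'n" where
  "coord p = inv idx (polar_order n p)"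

definition basis :: "nat \<Rightarrow> real ^ 'n" where
  "basis p = axis (coord p) 1"

lemma bij_coord: "bij_betw coord {1..n} UNIV"
  using bij_betw_trans[OF bij_betw_polar_order[OF card_ge_2] bij_betw_inv_into[OF bij_idx]]
  by (simp add: coord_def[abs_def] comp_def)

lemma idx_coord: "p \<in> {1..n} \<Longrightarrow> idx (coord p) = polar_order n p"
  using bij_betw_polar_order[OF card_ge_2] bij_idx
  by (metis bij_betw_apply bij_betw_inv_into_right coord_def)

sublocale orthonormal_family basis n
proof
  show "1 \<le> n"
    using card_ge_2 by simp
  show "basis p \<bullet> basis q = (if p = q then 1 else 0)" if "p \<in> {1..n}" "q \<in> {1..n}" for p q
    using that bij_coord by (auto simp: basis_def inner_axis_axis bij_betw_def inj_on_eq_iff)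
qed

lemma divergence_eq:
  assumes "(v has_derivative D) (at x)"
  shows "divergence v x = (\<Sum>p=1..n. D (basis p) \<bullet> basis p)"
proof -
  interpret D: bounded_linear D
    using assms by (rule has_derivative_bounded_linear)
  have "deriv (\<lambda>t. v (x + t *\<^sub>R axis j 1) $ j) 0 = D (axis j 1) \<bullet> axis j 1" for j
  proof -
    have "((\<lambda>t. x + t *\<^sub>R axis j 1) has_vector_derivative axis j 1) (at 0)"
      by (auto intro!: derivative_eq_intros)
    then have "((v \<circ> (\<lambda>t. x + t *\<^sub>R axis j 1)) has_vector_derivative D (axis j 1)) (at 0)"
      by (rule vector_derivative_diff_chain_within) (use has_derivative_at_withinI[OF assms] in simp)
    from bounded_linear.has_vector_derivative[OF bounded_linear_vec_nth this]
    show ?thesis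
      by (simp add: comp_def has_real_derivative_iff_has_vector_derivative[symmetric] DERIV_imp_deriv
          cart_eq_inner_axis)
  qed
  then show ?thesis
    by (simp add: divergence_def basis_def sum.reindex_bij_betw[OF bij_coord, symmetric])
qed

text \<open>With \<phi> stored in slot \<open>n - 1\<close> of the angle function, the
  parametrization is \<open>r\<close> times a tail, and the azimuth is treated like every other
  angle.\<close>

lemma polar_point_eq: "polar_point idx r \<theta> \<phi> = r *\<^sub>R tail (\<theta>(n - 1 := \<phi>)) 1"
proof -
  let ?\<alpha> = "\<theta>(n - 1 := \<phi>)"
  have "polar_coord n r \<theta> \<phi> (idx (coord p)) = r * (tail ?\<alpha> 1 $ coord p)" if p: "p \<in> {1..n}" for p
  proof -
    have 1: "(\<Prod>l=1..<m. sin (?\<alpha> l)) = (\<Prod>l=1..m-1. sin (\<theta> l))" if "1 \<le> m" "m < n" for m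
      using that by (intro prod.cong) auto
    have 2: "(\<Prod>l=1..<n. sin (?\<alpha> l)) = (\<Prod>l=1..n-2. sin (\<theta> l)) * sin \<phi>"
    proof -
      have "(\<Prod>l=1..<Suc (n-1). sin (?\<alpha> l)) = (\<Prod>l=1..<n-1. sin (?\<alpha> l)) * sin (?\<alpha> (n-1))"
        using card_ge_2 by (intro prod.atLeastLessThan_Suc) simp
      then show ?thesis
        using 1[of "n - 1"] card_ge_2 by (simp add: numeral_2_eq_2)
    qed
    have t: "tail ?\<alpha> 1 $ coord p = (\<Prod>l=1..<p. sin (?\<alpha> l)) * (if p < n then cos (?\<alpha> p) else 1)"
      using inner_tail_b[OF p] by (simp add: basis_def cart_eq_inner_axis)
    \<comment> \<open>By \<open>polar_order\<close> these are the Cartesian coordinates numbered 2,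
      1 and \<open>n + 1 - p\<close>; in the last case the cosine is that of angle
      \<open>p\<close>.\<close>
    consider "p = n" | "p = n - 1" "p < n" | "p < n - 1"
      using p by fastforce
    then show ?thesis
    proof cases
      case 1
      then show ?thesis
        unfolding t idx_coord[OF p] using 2 by (simp add: polar_order_def polar_coord_def)
    next
      case c: 2
      then have "n - 1 \<noteq> n"
        by simp
      with c show ?thesis
        unfolding t idx_coord[OF p] using 1[of p] p \<open>n - 1 \<noteq> n\<close>
        by (simp add: polar_order_def polar_coord_def numeral_2_eq_2)
    next
      case 3
      then have "n - (n + 1 - p) = p - 1"
        using p by auto
      with 3 show ?thesis
        unfolding t idx_coord[OF p] using 1[of p] p
        by (auto simp: polar_order_def polar_coord_def)
    qed
  qed
  moreover have "i \<in> coord ` {1..n}" for i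
    using bij_coord by (simp add: bij_betw_def)
  ultimately have "polar_coord n r \<theta> \<phi> (idx i) = r * (tail ?\<alpha> 1 $ i)" for i
    by (metis imageE)
  then show ?thesis
    by (simp add: polar_point_def card_eq vec_eq_iff)
qed

lemma upd_angle:
  assumes "k \<in> {1..n-2}"
  shows "(\<theta>(k := t))(n - 1 := \<phi>) = (\<theta>(n - 1 := \<phi>))(k := t)" "(\<theta>(n - 1 := \<phi>)) k = \<theta> k"
  using assms by (auto simp: fun_eq_iff)

text \<open>Index \<open>n - 1\<close> is left out because the sine of the azimuth can have any
  sign.\<close>

lemma sin_pos_angle:
  assumes "regular_polar n r \<theta>" "k \<in> {1..<n-1}"
  shows "0 < sin ((\<theta>(n - 1 := \<phi>)) k)"
  using assms by (auto simp: regular_polar_def intro!: sin_gt_zero)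

lemma polar_point_has_vector_derivative:
  assumes "k \<in> {1..<n}"
  shows "((\<lambda>t. r *\<^sub>R tail (\<alpha>(k := t)) 1) has_vector_derivative
    (r * (\<Prod>i=1..<k. sin (\<alpha> i))) *\<^sub>R frame \<alpha> k) (at (\<alpha> k))"
  using bounded_linear.has_vector_derivative[OF bounded_linear_scaleR_right
      tail_has_vector_derivative[of k 1 \<alpha>], of r] assms
  by simp

context
  fixes r \<phi> :: real and \<theta> \<alpha> :: "nat \<Rightarrow> real"
  assumes regular: "regular_polar n r \<theta>"
  defines "\<alpha> \<equiv> \<theta>(n - 1 := \<phi>)"
begin

text \<open>The scale factor is positive at a regular point, so normalizing removes exactly this
  factor.\<close>

lemma normalized_frame:
  assumes "k \<in> {1..<n}"
  shows "normalized (vector_derivative (\<lambda>t. r *\<^sub>R tail (\<alpha>(k := t)) 1) (at (\<alpha> k))) = frame \<alpha> k"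
proof (rule normalized_vector_derivative[OF polar_point_has_vector_derivative[OF assms]])
  have "0 < (\<Prod>i=1..<k. sin (\<alpha> i))"
    unfolding \<alpha>_def using assms by (intro prod_pos ballI sin_pos_angle[OF regular]) auto
  then show "0 < r * (\<Prod>i=1..<k. sin (\<alpha> i))"
    using regular by (simp add: regular_polar_def)
  show "norm (frame \<alpha> k) = 1"
    using assms by (simp add: norm_frame)
qed

lemma unit_r_eq: "unit_r idx r \<theta> \<phi> = tail \<alpha> 1"
  unfolding unit_r_def polar_point_eq \<alpha>_def[symmetric]
proof (rule normalized_vector_derivative[of _ 1])
  show "((\<lambda>s. s *\<^sub>R tail \<alpha> 1) has_vector_derivative 1 *\<^sub>R tail \<alpha> 1) (at r)"
    by (auto intro!: derivative_eq_intros)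
  show "norm (tail \<alpha> 1) = 1"
    using n_pos by (simp add: norm_eq_sqrt_inner inner_tail_tail)
qed simp

lemma unit_theta_eq:
  assumes k: "k \<in> {1..n-2}"
  shows "unit_theta idx k r \<theta> \<phi> = frame \<alpha> k"
proof -
  have "k \<in> {1..<n}"
    using k by auto
  from normalized_frame[OF this] show ?thesis
    unfolding unit_theta_def polar_point_eq upd_angle(1)[OF k] \<alpha>_def upd_angle(2)[OF k] .
qed

lemma unit_phi_eq: "unit_phi idx r \<theta> \<phi> = frame \<alpha> (n - 1)"
  using normalized_frame[of "n - 1"] card_ge_2
  by (simp add: unit_phi_def polar_point_eq \<alpha>_def)

lemma polar_components_eq:
  assumes comp: "polar_components idx \<Omega> v v\<^sub>r v\<^sub>\<theta> v\<^sub>\<phi>"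
    and point: "polar_point idx r \<theta> \<phi> \<in> \<Omega>"
  shows "v (r *\<^sub>R tail \<alpha> 1) \<bullet> tail \<alpha> 1 = v\<^sub>r r \<theta> \<phi>"
    and "k \<in> {1..n-2} \<Longrightarrow> v (r *\<^sub>R tail \<alpha> 1) \<bullet> frame \<alpha> k = v\<^sub>\<theta> k r \<theta> \<phi>"
    and "v (r *\<^sub>R tail \<alpha> 1) \<bullet> frame \<alpha> (n - 1) = v\<^sub>\<phi> r \<theta> \<phi>"
proof -
  \<comment> \<open>The azimuthal component becomes coefficient \<open>n - 1\<close>, so that
    \<open>frame_expansion\<close> applies to a single sum.\<close>
  let ?d = "\<lambda>k. if k = n - 1 then v\<^sub>\<phi> r \<theta> \<phi> else v\<^sub>\<theta> k r \<theta> \<phi>"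
  have "(\<Sum>k=1..n-2. v\<^sub>\<theta> k r \<theta> \<phi> *\<^sub>R unit_theta idx k r \<theta> \<phi>) = (\<Sum>k=1..n-2. ?d k *\<^sub>R frame \<alpha> k)"
    by (intro sum.cong refl) (auto simp: unit_theta_eq)
  then have y: "v (r *\<^sub>R tail \<alpha> 1) = v\<^sub>r r \<theta> \<phi> *\<^sub>R tail \<alpha> 1 + (\<Sum>k=1..<n. ?d k *\<^sub>R frame \<alpha> k)"
    using comp regular point unfolding polar_components_def card_eq sum_split_last[OF card_ge_2]
    by (simp add: unit_r_eq unit_phi_eq polar_point_eq \<alpha>_def)
  show "v (r *\<^sub>R tail \<alpha> 1) \<bullet> tail \<alpha> 1 = v\<^sub>r r \<theta> \<phi>"
    by (rule frame_expansion(1)[OF y])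
  show "v (r *\<^sub>R tail \<alpha> 1) \<bullet> frame \<alpha> k = v\<^sub>\<theta> k r \<theta> \<phi>" if "k \<in> {1..n-2}"
    using frame_expansion(2)[OF y, of k] that by auto
  show "v (r *\<^sub>R tail \<alpha> 1) \<bullet> frame \<alpha> (n - 1) = v\<^sub>\<phi> r \<theta> \<phi>"
    using frame_expansion(2)[OF y, of "n - 1"] card_ge_2 by auto
qed

end

section \<open>The divergence formula at regular points\<close>

lemma divergence_polar:
  assumes "open \<Omega>" and v: "(v has_derivative D) (at (polar_point idx r \<theta> \<phi>))"
    and comp: "polar_components idx \<Omega> v v\<^sub>r v\<^sub>\<theta> v\<^sub>\<phi>"
    and regular: "regular_polar n r \<theta>"
    and point: "polar_point idx r \<theta> \<phi> \<in> \<Omega>"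
  shows "(\<lambda>s. s ^ (n-1) * v\<^sub>r s \<theta> \<phi>) differentiable (at r)"
    and "k \<in> {1..n-2} \<Longrightarrow>
           (\<lambda>t. sin t ^ (n-1-k) * v\<^sub>\<theta> k r (\<theta>(k := t)) \<phi>) differentiable (at (\<theta> k))"
    and "(\<lambda>\<psi>. v\<^sub>\<phi> r \<theta> \<psi>) differentiable (at \<phi>)"
    and "divergence v (polar_point idx r \<theta> \<phi>) =
          1 / r ^ (n-1) * deriv (\<lambda>s. s ^ (n-1) * v\<^sub>r s \<theta> \<phi>) r
          + (\<Sum>k=1..n-2. 1 / (r * (\<Prod>i=1..k-1. sin (\<theta> i)) * sin (\<theta> k) ^ (n-1-k))
               * deriv (\<lambda>t. sin t ^ (n-1-k) * v\<^sub>\<theta> k r (\<theta>(k := t)) \<phi>) (\<theta> k))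
          + 1 / (r * (\<Prod>i=1..n-2. sin (\<theta> i))) * deriv (\<lambda>\<psi>. v\<^sub>\<phi> r \<theta> \<psi>) \<phi>"
proof -
  define \<alpha> where "\<alpha> = \<theta>(n - 1 := \<phi>)"
  define g where "g k t = (if k = n - 1 then v\<^sub>\<phi> r \<theta> t else v\<^sub>\<theta> k r (\<theta>(k := t)) \<phi>)" for k t
  have D: "(v has_derivative D) (at (r *\<^sub>R tail \<alpha> 1))" and in_\<Omega>: "r *\<^sub>R tail \<alpha> 1 \<in> \<Omega>"
    using v point by (simp_all add: polar_point_eq \<alpha>_def)
  have r: "r > 0"
    using regular by (simp add: regular_polar_def)
  have nz: "sin (\<alpha> i) \<noteq> 0" if "i \<in> {1..<n-1}" for i
    unfolding \<alpha>_def using sin_pos_angle[OF regular that] by (metis less_irrefl)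
  have radial: "eventually (\<lambda>s. v (s *\<^sub>R tail \<alpha> 1) \<bullet> tail \<alpha> 1 = v\<^sub>r s \<theta> \<phi>) (nhds r)"
  proof -
    have "((\<lambda>s. s *\<^sub>R tail \<alpha> 1) has_vector_derivative tail \<alpha> 1) (at r)"
      by (auto intro!: derivative_eq_intros)
    then have "eventually (\<lambda>s. s *\<^sub>R tail \<alpha> 1 \<in> \<Omega>) (nhds r)"
      using \<open>open \<Omega>\<close> in_\<Omega> by (rule eventually_nhds_curve_in_open)
    \<comment> \<open>The expansion is given for positive radii only, and positivity persists near
      \<open>r\<close>.\<close>
    moreover have "eventually (\<lambda>s. s \<in> {0<..}) (nhds r)"
      using r by (intro eventually_nhds_in_open) auto
    ultimately show ?thesis
    proof eventually_elim
      case (elim s)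
      then have "regular_polar n s \<theta>"
        using regular by (simp add: regular_polar_def)
      from polar_components_eq(1)[OF this comp] elim show ?case
        by (simp add: polar_point_eq \<alpha>_def)
    qed
  qed
  have angular: "eventually (\<lambda>t. v (r *\<^sub>R tail (\<alpha>(k := t)) 1) \<bullet> frame (\<alpha>(k := t)) k = g k t) (nhds (\<alpha> k))"
    if k: "k \<in> {1..<n}" for k
  proof -
    have ev: "eventually (\<lambda>t. r *\<^sub>R tail (\<alpha>(k := t)) 1 \<in> \<Omega>) (nhds (\<alpha> k))"
      by (rule eventually_nhds_curve_in_open[OF polar_point_has_vector_derivative[OF k] \<open>open \<Omega>\<close>])
         (use in_\<Omega> in simp)
    show ?thesis
    proof (cases "k = n - 1")
      \<comment> \<open>Regularity does not restrict the azimuth, so the expansion holds on both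
        sides of \<phi>, even at 0 and 2 pi.\<close>
      case True
      from ev show ?thesis
      proof eventually_elim
        case (elim t)
        then show ?case
          using polar_components_eq(3)[OF regular comp, of t] True
          by (simp add: polar_point_eq \<alpha>_def g_def)
      qed
    next
      case False
      with k have k': "k \<in> {1..n-2}"
        by auto
      then have "\<alpha> k \<in> {0<..<pi}"
        using regular False by (simp add: \<alpha>_def regular_polar_def)
      \<comment> \<open>The varied angle stays between 0 and \<open>pi\<close> near its value, which
        keeps the updated angles regular.\<close>
      then have "eventually (\<lambda>t. t \<in> {0<..<pi}) (nhds (\<alpha> k))"
        by (intro eventually_nhds_in_open) auto
      with ev show ?thesis
      proof eventually_elim
        case (elim t)
        then have "regular_polar n r (\<theta>(k := t))"
          using regular by (simp add: regular_polar_def)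
        note polar_components_eq(2)[OF this comp, of \<phi> k, unfolded polar_point_eq upd_angle(1)[OF k'],
            folded \<alpha>_def, OF elim(1) k']
        then show ?case
          using False by (simp add: g_def)
      qed
    qed
  qed
  note main = trace_in_polar_coordinates[OF D r nz radial angular]
  show "(\<lambda>s. s ^ (n-1) * v\<^sub>r s \<theta> \<phi>) differentiable (at r)"
    by (rule main(1))
  show "(\<lambda>t. sin t ^ (n-1-k) * v\<^sub>\<theta> k r (\<theta>(k := t)) \<phi>) differentiable (at (\<theta> k))" if "k \<in> {1..n-2}"
  proof -
    have "k \<in> {1..<n}" "k \<noteq> n - 1"
      using that by auto
    then show ?thesis
      using main(2)[of k] by (simp add: g_def \<alpha>_def)
  qed
  show "(\<lambda>\<psi>. v\<^sub>\<phi> r \<theta> \<psi>) differentiable (at \<phi>)"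
    using main(2)[of "n - 1"] card_ge_2 by (simp add: g_def \<alpha>_def)
  have S: "(\<Prod>i=1..<k. sin (\<alpha> i)) = (\<Prod>i=1..k-1. sin (\<theta> i))" if "k \<in> {1..<n}" for k
    using that by (intro prod.cong) (auto simp: \<alpha>_def)
  have angle: "1 / (r * (\<Prod>i=1..<k. sin (\<alpha> i)) * sin (\<alpha> k) ^ (n-1-k)) * deriv (\<lambda>t. sin t ^ (n-1-k) * g k t) (\<alpha> k)
      = 1 / (r * (\<Prod>i=1..k-1. sin (\<theta> i)) * sin (\<theta> k) ^ (n-1-k))
          * deriv (\<lambda>t. sin t ^ (n-1-k) * v\<^sub>\<theta> k r (\<theta>(k := t)) \<phi>) (\<theta> k)" if "k \<in> {1..n-2}" for k
  proof -
    have k: "k \<in> {1..<n}" "k \<noteq> n - 1"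
      using that by auto
    then show ?thesis
      unfolding S[OF k(1)] by (simp add: g_def \<alpha>_def)
  qed
  \<comment> \<open>The azimuth has exponent 0, so its sine disappears from the prefactor and from
    under the derivative.\<close>
  have azimuth: "1 / (r * (\<Prod>i=1..<n-1. sin (\<alpha> i)) * sin (\<alpha> (n-1)) ^ (n-1-(n-1)))
        * deriv (\<lambda>t. sin t ^ (n-1-(n-1)) * g (n-1) t) (\<alpha> (n-1))
      = 1 / (r * (\<Prod>i=1..n-2. sin (\<theta> i))) * deriv (\<lambda>\<psi>. v\<^sub>\<phi> r \<theta> \<psi>) \<phi>"
    using S[of "n - 1"] card_ge_2 by (simp add: g_def \<alpha>_def numeral_2_eq_2)
  have "divergence v (polar_point idx r \<theta> \<phi>) = 1 / r ^ (n-1) * deriv (\<lambda>s. s ^ (n-1) * v\<^sub>r s \<theta> \<phi>) r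
      + (\<Sum>k=1..<n. 1 / (r * (\<Prod>i=1..<k. sin (\<alpha> i)) * sin (\<alpha> k) ^ (n-1-k))
          * deriv (\<lambda>t. sin t ^ (n-1-k) * g k t) (\<alpha> k))"
    unfolding divergence_eq[OF v] by (rule main(3))
  then show "divergence v (polar_point idx r \<theta> \<phi>) =
          1 / r ^ (n-1) * deriv (\<lambda>s. s ^ (n-1) * v\<^sub>r s \<theta> \<phi>) r
          + (\<Sum>k=1..n-2. 1 / (r * (\<Prod>i=1..k-1. sin (\<theta> i)) * sin (\<theta> k) ^ (n-1-k))
               * deriv (\<lambda>t. sin t ^ (n-1-k) * v\<^sub>\<theta> k r (\<theta>(k := t)) \<phi>) (\<theta> k))
          + 1 / (r * (\<Prod>i=1..n-2. sin (\<theta> i))) * deriv (\<lambda>\<psi>. v\<^sub>\<phi> r \<theta> \<psi>) \<phi>"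
    unfolding sum_split_last[OF card_ge_2] by (simp only: sum.cong[OF refl angle] azimuth add.assoc)
qed

end

theorem mainTheorem1:
  fixes n :: nat
    and idx :: "'n::finite \<Rightarrow> nat"
    and \<Omega> :: "(real ^ 'n) set"
    and v :: "real ^ 'n \<Rightarrow> real ^ 'n"
    and v\<^sub>r v\<^sub>\<phi> :: "real \<Rightarrow> (nat \<Rightarrow> real) \<Rightarrow> real \<Rightarrow> real"
    and v\<^sub>\<theta> :: "nat \<Rightarrow> real \<Rightarrow> (nat \<Rightarrow> real) \<Rightarrow> real \<Rightarrow> real"
    and r \<phi> :: real and \<theta> :: "nat \<Rightarrow> real"
  assumes n: "n = CARD('n)" "n \<ge> 2"
    and idx: "bij_betw idx UNIV {1..n}"
    and Omega: "(\<exists>R. 0 < R \<and> \<Omega> = {x. norm x < R}) \<or>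
                (\<exists>R\<^sub>i R\<^sub>o. 0 < R\<^sub>i \<and> R\<^sub>i < R\<^sub>o \<and> \<Omega> = {x. R\<^sub>i < norm x \<and> norm x < R\<^sub>o})"
    and v: "continuously_differentiable_on v \<Omega>"
    and components: "polar_components idx \<Omega> v v\<^sub>r v\<^sub>\<theta> v\<^sub>\<phi>"
    and regular: "regular_polar n r \<theta>" "0 \<le> \<phi>" "\<phi> \<le> 2 * pi"
    and point: "polar_point idx r \<theta> \<phi> \<in> \<Omega>"
  shows
    "(n = 2 \<longrightarrow>
        (\<lambda>s. s * v\<^sub>r s \<theta> \<phi>) differentiable (at r) \<and>
        (\<lambda>\<psi>. v\<^sub>\<phi> r \<theta> \<psi>) differentiable (at \<phi>) \<and>
        divergence v (polar_point idx r \<theta> \<phi>) =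
          1 / r * (deriv (\<lambda>s. s * v\<^sub>r s \<theta> \<phi>) r + deriv (\<lambda>\<psi>. v\<^sub>\<phi> r \<theta> \<psi>) \<phi>)) \<and>
     (n \<ge> 3 \<longrightarrow>
        (\<lambda>s. s ^ (n-1) * v\<^sub>r s \<theta> \<phi>) differentiable (at r) \<and>
        (\<forall>k\<in>{1..n-2}.
           (\<lambda>t. sin t ^ (n-1-k) * v\<^sub>\<theta> k r (\<theta>(k := t)) \<phi>) differentiable (at (\<theta> k))) \<and>
        (\<lambda>\<psi>. v\<^sub>\<phi> r \<theta> \<psi>) differentiable (at \<phi>) \<and>
        divergence v (polar_point idx r \<theta> \<phi>) =
          1 / r ^ (n-1) * deriv (\<lambda>s. s ^ (n-1) * v\<^sub>r s \<theta> \<phi>) r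
          + (\<Sum>k=1..n-2. 1 / (r * (\<Prod>i=1..k-1. sin (\<theta> i)) * sin (\<theta> k) ^ (n-1-k))
               * deriv (\<lambda>t. sin t ^ (n-1-k) * v\<^sub>\<theta> k r (\<theta>(k := t)) \<phi>) (\<theta> k))
          + 1 / (r * (\<Prod>i=1..n-2. sin (\<theta> i))) * deriv (\<lambda>\<psi>. v\<^sub>\<phi> r \<theta> \<psi>) \<phi>)"
proof -
  interpret polar_coordinates idx n
    using idx n by unfold_locales simp_all
  have op: "open \<Omega>"
  proof -
    have "{x::real ^ 'n. norm x < R} = ball 0 R" for R
      by auto
    moreover have "{x::real ^ 'n. R\<^sub>i < norm x \<and> norm x < R\<^sub>o} = ball 0 R\<^sub>o - cball 0 R\<^sub>i" for R\<^sub>i R\<^sub>o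
      by auto
    ultimately show ?thesis
      using Omega by (auto simp: open_Diff)
  qed
  obtain D where D: "(v has_derivative D) (at (polar_point idx r \<theta> \<phi>))"
    using v point unfolding continuously_differentiable_on_def by blast
  note polar = divergence_polar[OF op D components regular(1) point]
  show ?thesis
  proof (intro conjI impI ballI)
    \<comment> \<open>Here the sum over polar angles and the product of sines are empty, and the
      power of the radius is 1.\<close>
    assume "n = 2"
    then show "(\<lambda>s. s * v\<^sub>r s \<theta> \<phi>) differentiable (at r)"
      and "divergence v (polar_point idx r \<theta> \<phi>) =
          1 / r * (deriv (\<lambda>s. s * v\<^sub>r s \<theta> \<phi>) r + deriv (\<lambda>\<psi>. v\<^sub>\<phi> r \<theta> \<psi>) \<phi>)"
      using polar(1,4) by (simp_all add: distrib_left)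
  qed (rule polar; assumption)+
qed

end
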